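(* Let $\mathcal Q$ be the set of graphs on $n$ vertices containing no induced subgraph with $4$ vertices and $3$ edges. Then $$\left\lfloor\frac{n^2-5n}{4}\right\rfloor\le\mathrm{Dist}(n,\mathcal Q)\le\frac{n^2-n}{4}.$$
   Context: An edge-operation is the deletion of an existing edge or the addition of a non-existing edge. For an $n$-vertex graph $G$ and a family $\mathcal H$ of $n$-vertex graphs, $\mathrm{Dist}(G,\mathcal H)$ is the minimum of $|E(G)\,\Delta\,E(G')|$ over graphs $G'$ on vertex set $V(G)$ isomorphic to a member of $\mathcal H$, and $\mathrm{Dist}(n,\mathcal H)=\max\{\mathrm{Dist}(G,\mathcal H):|V(G)|=n\}$. *)

theory Defs
  imports Complex_Main
begin

type_synonym 'a graph = "'a set \<times> 'a set set"

abbreviation verts :: "'a graph \<Rightarrow> 'a set" where "verts G \<equiv> fst G"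

abbreviation edges :: "'a graph \<Rightarrow> 'a set set" where "edges G \<equiv> snd G"

definition simple_graph :: "'a graph \<Rightarrow> bool" where
  "simple_graph G \<longleftrightarrow> finite (verts G) \<and> (\<forall>e\<in>edges G. e \<subseteq> verts G \<and> card e = 2)"

definition isomorphic :: "'a graph \<Rightarrow> 'b graph \<Rightarrow> bool" where
  "isomorphic G H \<longleftrightarrow> (\<exists>f. bij_betw f (verts G) (verts H) \<and>
     (\<forall>u\<in>verts G. \<forall>v\<in>verts G. {u, v} \<in> edges G \<longleftrightarrow> {f u, f v} \<in> edges H))"

definition induced_subgraph :: "'a graph \<Rightarrow> 'a graph \<Rightarrow> bool" where
  "induced_subgraph H G \<longleftrightarrow> verts H \<subseteq> verts G \<and> edges H = {e \<in> edges G. e \<subseteq> verts H}"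

text \<open>The minimum is over a finite set of naturals (bounded by the number of vertex pairs), which
  is nonempty if and only if the family contains a graph with as many vertices as \<open>G\<close>.\<close>
definition edit_dist :: "'a graph \<Rightarrow> 'b graph set \<Rightarrow> nat" where
  "edit_dist G \<H> = Min {card ((edges G - edges G') \<union> (edges G' - edges G)) | G'.
     simple_graph G' \<and> verts G' = verts G \<and> (\<exists>H\<in>\<H>. isomorphic G' H)}"

text \<open>Every finite graph is isomorphic to one whose vertices are natural numbers, and
  \<open>edit_dist\<close> is invariant under isomorphism, so restricting to vertices of type
  \<^typ>\<open>nat\<close> loses nothing.\<close>
definition max_edit_dist :: "nat \<Rightarrow> 'b graph set \<Rightarrow> nat" where
  "max_edit_dist n \<H> = Max {edit_dist G \<H> | G :: nat graph. simple_graph G \<and> card (verts G) = n}"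

definition no_induced_4_3 :: "nat \<Rightarrow> nat graph set" where
  "no_induced_4_3 n = {G. simple_graph G \<and> card (verts G) = n \<and>
     \<not> (\<exists>H. induced_subgraph H G \<and> card (verts H) = 4 \<and> card (edges H) = 3)}"

end

theory Submission
  imports Defs
begin

text \<open>
  Call a graph good if no four vertices span exactly three edges. The complement of a good graph is
  good, since three is half of the six pairs. A good graph cannot contain both a triangle and an
  independent triple: this is a check on the at most six vertices involved. In a good triangle-free
  graph all degrees are at most two, because three neighbours of a vertex would span a claw with it,
  so there are at most \<open>n\<close> edges. Hence every good graph has at most \<open>n\<close> edges or at most \<open>n\<close>
  non-edges, and a graph with half of all the pairs as edges is far from all of them. For the upper
  bound, the empty graph and the complete graph are good.
\<close>

section \<open>Good graphs and their complements\<close>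

definition pairs :: "'a set \<Rightarrow> 'a set set" where
  "pairs V = {e. e \<subseteq> V \<and> card e = 2}"

text \<open>Membership in \<open>no_induced_4_3\<close>, unbundled: with the edge set as a separate
  argument and the order left free, the complement is just \<open>pairs V - E\<close>.\<close>

definition good :: "'a set \<Rightarrow> 'a set set \<Rightarrow> bool" where
  "good V E \<longleftrightarrow> finite V \<and> E \<subseteq> pairs V \<and>
     (\<forall>W\<subseteq>V. card W = 4 \<longrightarrow> card {e \<in> E. e \<subseteq> W} \<noteq> 3)"

lemma finite_pairs: "finite V \<Longrightarrow> finite (pairs V)"
  unfolding pairs_def by simp

lemma card_pairs: "finite V \<Longrightarrow> card (pairs V) = card V choose 2"
  unfolding pairs_def by (rule n_subsets)

lemma simple_graph_iff: "simple_graph G \<longleftrightarrow> finite (verts G) \<and> edges G \<subseteq> pairs (verts G)"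
  unfolding simple_graph_def pairs_def by auto

lemma good_if_no_induced_4_3:
  assumes "H \<in> no_induced_4_3 n"
  shows "good (verts H) (edges H)"
  unfolding good_def
proof (intro conjI allI impI)
  show "finite (verts H)" "edges H \<subseteq> pairs (verts H)"
    using assms by (auto simp: no_induced_4_3_def simple_graph_iff)
next
  fix W assume W: "W \<subseteq> verts H" "card W = 4"
  then have "induced_subgraph (W, {e \<in> edges H. e \<subseteq> W}) H"
    by (simp add: induced_subgraph_def)
  then show "card {e \<in> edges H. e \<subseteq> W} \<noteq> 3"
    using assms W unfolding no_induced_4_3_def by fastforce
qed

lemma no_induced_4_3_if_good:
  assumes "good V E" "card V = n"
  shows "(V, E) \<in> no_induced_4_3 n"
  using assms unfolding no_induced_4_3_def good_def induced_subgraph_def simple_graph_iff by auto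

lemma good_empty: "finite V \<Longrightarrow> good V {}"
  unfolding good_def by simp

lemma good_complement:
  assumes "good V E"
  shows "good V (pairs V - E)"
  unfolding good_def
proof (intro conjI allI impI)
  show "finite V" using assms by (simp add: good_def)
  show "pairs V - E \<subseteq> pairs V" by blast
next
  fix W assume W: "W \<subseteq> V" "card W = 4"
  have fin: "finite W" using W(2) card.infinite by fastforce
  have E: "E \<subseteq> pairs V" using assms by (simp add: good_def)
  have eq: "{e \<in> pairs V - E. e \<subseteq> W} = pairs W - {e \<in> E. e \<subseteq> W}"
    using W(1) by (auto simp: pairs_def)
  have sub: "{e \<in> E. e \<subseteq> W} \<subseteq> pairs W" using E by (auto simp: pairs_def)
  have "card (pairs W) = 6" using card_pairs[OF fin] W(2) by (simp add: choose_two)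
  then have "card {e \<in> pairs V - E. e \<subseteq> W} = 6 - card {e \<in> E. e \<subseteq> W}"
    unfolding eq using card_Diff_subset[OF finite_subset[OF sub finite_pairs[OF fin]] sub] by simp
  moreover have "card {e \<in> E. e \<subseteq> W} \<noteq> 3" using assms W by (simp add: good_def)
  ultimately show "card {e \<in> pairs V - E. e \<subseteq> W} \<noteq> 3" by linarith
qed

section \<open>Conditions on four named vertices\<close>

lemma pairs_four:
  assumes "distinct [a, b, c, d]"
  shows "pairs {a, b, c, d} = {{a, b}, {a, c}, {a, d}, {b, c}, {b, d}, {c, d}}"
proof (rule card_subset_eq[symmetric])
  show "finite (pairs {a, b, c, d})" by (simp add: finite_pairs)
  show "{{a, b}, {a, c}, {a, d}, {b, c}, {b, d}, {c, d}} \<subseteq> pairs {a, b, c, d}"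
    using assms by (simp add: pairs_def)
  show "card {{a, b}, {a, c}, {a, d}, {b, c}, {b, d}, {c, d}} = card (pairs {a, b, c, d})"
    using assms by (simp add: card_pairs choose_two doubleton_eq_iff)
qed

text \<open>Turns the condition on vertex sets into arithmetic on six adjacencies, so that the later
  case checks are left to the simplifier.\<close>

lemma good_four:
  assumes "good V E" "distinct [a, b, c, d]" "{a, b, c, d} \<subseteq> V"
  shows "of_bool ({a, b} \<in> E) + of_bool ({a, c} \<in> E) + of_bool ({a, d} \<in> E) +
    of_bool ({b, c} \<in> E) + of_bool ({b, d} \<in> E) + of_bool ({c, d} \<in> E) \<noteq> (3 :: nat)"
proof -
  have "{e \<in> E. e \<subseteq> {a, b, c, d}} = pairs {a, b, c, d} \<inter> {e. e \<in> E}"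
    using assms(1) by (auto simp: good_def pairs_def)
  then have "card {e \<in> E. e \<subseteq> {a, b, c, d}} = (\<Sum>e\<in>pairs {a, b, c, d}. of_bool (e \<in> E))"
    by (simp add: finite_pairs)
  also have "\<dots> = of_bool ({a, b} \<in> E) + of_bool ({a, c} \<in> E) + of_bool ({a, d} \<in> E) +
    of_bool ({b, c} \<in> E) + of_bool ({b, d} \<in> E) + of_bool ({c, d} \<in> E)"
    using assms(2) by (simp add: pairs_four doubleton_eq_iff)
  moreover have "card {e \<in> E. e \<subseteq> {a, b, c, d}} \<noteq> 3"
    using assms by (simp add: good_def)
  ultimately show ?thesis by metis
qed

lemma good_no_claw:
  assumes "good V E" "distinct [x, a, b, c]" "{x, a, b, c} \<subseteq> V"
    and "{x, a} \<in> E" "{x, b} \<in> E" "{x, c} \<in> E"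
  shows "{a, b} \<in> E \<or> {a, c} \<in> E \<or> {b, c} \<in> E"
  using good_four[OF assms(1), of x a b c] assms by (auto split: if_splits)

section \<open>A triangle excludes an independent triple\<close>

definition has_triangle :: "'a set \<Rightarrow> 'a set set \<Rightarrow> bool" where
  "has_triangle V E \<longleftrightarrow> (\<exists>x\<in>V. \<exists>y\<in>V. \<exists>z\<in>V. distinct [x, y, z] \<and> {x, y} \<in> E \<and> {x, z} \<in> E \<and> {y, z} \<in> E)"

text \<open>The adjacency matrix between a triangle (rows \<open>p\<close>, \<open>q\<close>, \<open>r\<close>) and an independent triple (columns):
  the assumptions exclude the triangle plus an isolated vertex, the claw, and two vertices from each
  side spanning three edges.\<close>
lemma bool_matrix_3_3:
  assumes "p1 \<or> q1 \<or> r1" "p2 \<or> q2 \<or> r2" "p3 \<or> q3 \<or> r3"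
    and "\<not> (p1 \<and> p2 \<and> p3)" "\<not> (q1 \<and> q2 \<and> q3)" "\<not> (r1 \<and> r2 \<and> r3)"
    and "of_bool p1 + of_bool p2 + of_bool q1 + of_bool q2 \<noteq> (2 :: nat)"
    and "of_bool p1 + of_bool p3 + of_bool q1 + of_bool q3 \<noteq> (2 :: nat)"
    and "of_bool p2 + of_bool p3 + of_bool q2 + of_bool q3 \<noteq> (2 :: nat)"
    and "of_bool p1 + of_bool p2 + of_bool r1 + of_bool r2 \<noteq> (2 :: nat)"
    and "of_bool p1 + of_bool p3 + of_bool r1 + of_bool r3 \<noteq> (2 :: nat)"
    and "of_bool p2 + of_bool p3 + of_bool r2 + of_bool r3 \<noteq> (2 :: nat)"
  shows False
  using assms by (cases p1; cases p2; cases p3; cases q1; cases q2; cases q3; simp)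

text \<open>Consider the adjacency matrix between \<open>x\<close>, \<open>y\<close> and
  \<open>a\<close>, \<open>b\<close>. The four-sets containing \<open>s\<close> force a true entry
  in every column and forbid two in a row, so exactly two entries are true. Together with the edge
  \<open>{x, y}\<close> they give three edges on \<open>x\<close>, \<open>y\<close>,
  \<open>a\<close>, \<open>b\<close>.\<close>

lemma good_no_triangle_and_independent_triple_meeting:
  assumes good: "good V E" and V: "{s, x, y, a, b} \<subseteq> V"
    and dist: "distinct [s, x, y]" "distinct [s, a, b]"
    and T: "{s, x} \<in> E" "{s, y} \<in> E" "{x, y} \<in> E"
    and I: "{s, a} \<notin> E" "{s, b} \<notin> E" "{a, b} \<notin> E"
  shows False
proof -
  \<comment> \<open>A second common vertex would make some pair at \<open>s\<close> both an edge and
    a non-edge.\<close>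
  have ne: "a \<noteq> x" "a \<noteq> y" "b \<noteq> x" "b \<noteq> y" using T I by auto
  have "{x, a} \<in> E \<or> {y, a} \<in> E"
    using good_four[OF good, of s x y a] V dist T I ne by auto
  moreover have "{x, b} \<in> E \<or> {y, b} \<in> E"
    using good_four[OF good, of s x y b] V dist T I ne by auto
  moreover have "\<not> ({x, a} \<in> E \<and> {x, b} \<in> E)"
    using good_four[OF good, of s x a b] V dist T I ne by auto
  moreover have "\<not> ({y, a} \<in> E \<and> {y, b} \<in> E)"
    using good_four[OF good, of s y a b] V dist T I ne by auto
  moreover have "of_bool ({x, a} \<in> E) + of_bool ({x, b} \<in> E) + of_bool ({y, a} \<in> E) +
      of_bool ({y, b} \<in> E) \<noteq> (2 :: nat)"
    using good_four[OF good, of x y a b] V dist T I ne by auto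
  ultimately show False by auto
qed

lemma good_no_triangle_and_independent_triple_disjoint:
  assumes good: "good V E" and V: "{x, y, z, a, b, c} \<subseteq> V"
    and dist: "distinct [x, y, z, a, b, c]"
    and T: "{x, y} \<in> E" "{x, z} \<in> E" "{y, z} \<in> E"
    and I: "{a, b} \<notin> E" "{a, c} \<notin> E" "{b, c} \<notin> E"
  shows False
proof -
  have col: "{x, u} \<in> E \<or> {y, u} \<in> E \<or> {z, u} \<in> E"
    if "u \<in> V" "distinct [x, y, z, u]" for u
    using good_four[OF good that(2)] that V T by auto
  have row: "\<not> ({t, a} \<in> E \<and> {t, b} \<in> E \<and> {t, c} \<in> E)"
    if "t \<in> V" "distinct [t, a, b, c]" for t
    using good_four[OF good that(2)] that V I by auto
  \<comment> \<open>The edge \<open>{t, t'}\<close> and the non-edge \<open>{u, v}\<close>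
    contribute one edge, so two cross edges would make three.\<close>
  have minor: "of_bool ({t, u} \<in> E) + of_bool ({t, v} \<in> E) + of_bool ({t', u} \<in> E) +
      of_bool ({t', v} \<in> E) \<noteq> (2 :: nat)"
    if "{t, t', u, v} \<subseteq> V" "distinct [t, t', u, v]" "{t, t'} \<in> E" "{u, v} \<notin> E" for t t' u v
    using good_four[OF good that(2,1)] that(3,4) by auto
  show False
    by (rule bool_matrix_3_3[OF col[of a] col[of b] col[of c] row[of x] row[of y] row[of z]
          minor[of x y a b] minor[of x y a c] minor[of x y b c]
          minor[of x z a b] minor[of x z a c] minor[of x z b c]])
      (use V dist T I in simp_all)
qed

text \<open>Relabels a triple so that a chosen vertex comes first. \<open>F\<close> is arbitrary, so
  the lemma also serves independent triples, with \<open>- E\<close> for \<open>F\<close>.\<close>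

lemma triple_starting_at:
  assumes "distinct [x, y, z]" "{x, y} \<in> F" "{x, z} \<in> F" "{y, z} \<in> F" "u \<in> {x, y, z}"
  obtains p q where "{u, p, q} = {x, y, z}" "distinct [u, p, q]"
    "{u, p} \<in> F" "{u, q} \<in> F" "{p, q} \<in> F"
proof -
  consider "u = x" | "u = y" | "u = z" using assms(5) by blast
  then show thesis
  proof cases
    case 1 then show thesis using that[of y z] assms by simp
  next
    case 2 then show thesis using that[of x z] assms by (auto simp: insert_commute)
  next
    case 3 then show thesis using that[of x y] assms by (auto simp: insert_commute)
  qed
qed

lemma good_triangle_free_or_complement:
  assumes "good V E"
  shows "\<not> has_triangle V E \<or> \<not> has_triangle V (pairs V - E)"
proof (rule ccontr)
  assume "\<not> ?thesis"
  \<comment> \<open>A triangle of the complement is an independent triple of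
    \<open>E\<close>.\<close>
  then obtain x y z a b c where
    T: "{x, y, z} \<subseteq> V" "distinct [x, y, z]" "{x, y} \<in> E" "{x, z} \<in> E" "{y, z} \<in> E" and
    I: "{a, b, c} \<subseteq> V" "distinct [a, b, c]" "{a, b} \<notin> E" "{a, c} \<notin> E" "{b, c} \<notin> E"
    unfolding has_triangle_def by auto
  have meet: False if u: "u \<in> {x, y, z}" "u \<in> {a, b, c}" for u
  proof -
    obtain p q where pq: "{u, p, q} = {x, y, z}" "distinct [u, p, q]"
      "{u, p} \<in> E" "{u, q} \<in> E" "{p, q} \<in> E"
      using triple_starting_at[OF T(2-5) u(1)] by blast
    obtain r s where rs: "{u, r, s} = {a, b, c}" "distinct [u, r, s]"
      "{u, r} \<notin> E" "{u, s} \<notin> E" "{r, s} \<notin> E"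
      using triple_starting_at[of a b c "- E" u] I(2-5) u(2) by auto
    have "{u, p, q, r, s} \<subseteq> V" using pq(1) rs(1) T(1) I(1) by blast
    then show False
      using good_no_triangle_and_independent_triple_meeting[OF assms _ pq(2) rs(2) pq(3-5) rs(3-5)] by simp
  qed
  have "distinct [x, y, z, a, b, c]" using T(2) I(2) meet by auto
  moreover have "{x, y, z, a, b, c} \<subseteq> V" using T(1) I(1) by blast
  ultimately show False
    using good_no_triangle_and_independent_triple_disjoint[OF assms _ _ T(3-5) I(3-5)] by simp
qed

section \<open>Counting the edges of a good graph\<close>

lemma triangle_free_good_degree_le_2:
  assumes good: "good V E" and tf: "\<not> has_triangle V E" and v: "v \<in> V"
  shows "card {e \<in> E. v \<in> e} \<le> 2"
proof (rule ccontr)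
  assume "\<not> ?thesis"
  then obtain F where F: "F \<subseteq> {e \<in> E. v \<in> e}" "card F = 3"
    using obtain_subset_with_card_n[of 3 "{e \<in> E. v \<in> e}"] by (metis not_less_eq_eq numeral_2_eq_2 numeral_3_eq_3)
  have other: "\<exists>u\<in>V. u \<noteq> v \<and> e = {v, u}" if "e \<in> F" for e
  proof -
    have "e \<subseteq> V" "card e = 2" "v \<in> e" using that F(1) good by (auto simp: good_def pairs_def)
    then show ?thesis by (auto simp: card_2_iff)
  qed
  obtain e f g where efg: "F = {e, f, g}" "e \<noteq> f" "e \<noteq> g" "f \<noteq> g"
    using F(2) unfolding card_3_iff by blast
  obtain a where a: "a \<in> V" "a \<noteq> v" "e = {v, a}" using other[of e] efg(1) by blast
  obtain b where b: "b \<in> V" "b \<noteq> v" "f = {v, b}" using other[of f] efg(1) by blast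
  obtain c where c: "c \<in> V" "c \<noteq> v" "g = {v, c}" using other[of g] efg(1) by blast
  have abc: "distinct [a, b, c]" using efg a b c by auto
  have E: "{v, a} \<in> E" "{v, b} \<in> E" "{v, c} \<in> E" using F(1) efg(1) a b c by auto
  then have "{a, b} \<in> E \<or> {a, c} \<in> E \<or> {b, c} \<in> E"
    using good_no_claw[OF good, of v a b c] abc a b c v by auto
  \<comment> \<open>An edge between two neighbours of \<open>v\<close> closes a triangle at
    \<open>v\<close>.\<close>
  moreover have "has_triangle V E"
    if "{p, q} \<in> E" "{v, p} \<in> E" "{v, q} \<in> E" "p \<in> V" "q \<in> V" "distinct [v, p, q]" for p q
    unfolding has_triangle_def using v that by blast
  ultimately show False
    using tf abc a b c E by auto
qed

lemma triangle_free_good_card_le: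
  assumes "good V E" "\<not> has_triangle V E"
  shows "card E \<le> card V"
proof -
  have fin: "finite V" "finite E" and E: "E \<subseteq> pairs V"
    using assms(1) finite_subset[OF _ finite_pairs] by (auto simp: good_def)
  \<comment> \<open>Handshake lemma: incidences are counted by vertices and by edges.\<close>
  have "2 * card E = (\<Sum>v\<in>V. card {e \<in> E. v \<in> e})"
  proof -
    have "card {v \<in> V. v \<in> e} = 2" if "e \<in> E" for e
    proof -
      have "{v \<in> V. v \<in> e} = e" "card e = 2" using that E by (auto simp: pairs_def)
      then show ?thesis by simp
    qed
    then show ?thesis using sum_multicount[OF fin, of "\<lambda>v e. v \<in> e" 2] by simp
  qed
  also have "\<dots> \<le> (\<Sum>v\<in>V. 2)"
    by (rule sum_mono) (rule triangle_free_good_degree_le_2[OF assms])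
  finally show ?thesis by simp
qed

text \<open>Whichever of the graph and its complement is triangle-free has at most
  \<open>card V\<close> edges. The second disjunct is the bound on non-edges, written without
  truncated subtraction.\<close>

lemma good_few_or_many_edges:
  assumes "good V E"
  shows "card E \<le> card V \<or> card V choose 2 \<le> card E + card V"
proof -
  have "finite V" "E \<subseteq> pairs V" using assms by (auto simp: good_def)
  then have "card (pairs V - E) = (card V choose 2) - card E"
    by (simp add: card_Diff_subset card_pairs finite_subset[OF _ finite_pairs])
  then show ?thesis
    using good_triangle_free_or_complement[OF assms] triangle_free_good_card_le[OF assms]
      triangle_free_good_card_le[OF good_complement[OF assms]] by linarith
qed

section \<open>Isomorphism and edit distance\<close>

lemma simple_graph_edgeE:
  assumes "simple_graph G" "e \<in> edges G"
  obtains u v where "u \<in> verts G" "v \<in> verts G" "e = {u, v}"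
proof -
  have "e \<subseteq> verts G" "card e = 2" using assms by (auto simp: simple_graph_def)
  then show thesis using that by (auto simp: card_2_iff)
qed

text \<open>An edited graph is only isomorphic to a member of the family; this carries the edge
  count of that member over to it.\<close>

lemma isomorphic_card_edges:
  assumes "simple_graph G" "simple_graph H" "isomorphic G H"
  shows "card (edges G) = card (edges H)"
proof -
  obtain f where f: "bij_betw f (verts G) (verts H)" and
    iff: "\<And>u v. u \<in> verts G \<Longrightarrow> v \<in> verts G \<Longrightarrow> {u, v} \<in> edges G \<longleftrightarrow> {f u, f v} \<in> edges H"
    using assms(3) unfolding isomorphic_def by blast
  have "inj_on (image f) (edges G)"
    using f assms(1) unfolding bij_betw_def simple_graph_def
    by (intro inj_onI) (metis inj_on_image_eq_iff)
  moreover have "image f ` edges G = edges H"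
  proof (intro equalityI subsetI)
    fix e assume "e \<in> image f ` edges G"
    then obtain e' where e': "e' \<in> edges G" "e = f ` e'" by blast
    obtain u v where "u \<in> verts G" "v \<in> verts G" "e' = {u, v}"
      using simple_graph_edgeE[OF assms(1) e'(1)] by blast
    then show "e \<in> edges H" using iff[of u v] e' by simp
  next
    fix e assume e: "e \<in> edges H"
    obtain u v where "u \<in> verts H" "v \<in> verts H" and uv: "e = {u, v}"
      using simple_graph_edgeE[OF assms(2) e] by blast
    then obtain u' v' where "u' \<in> verts G" "v' \<in> verts G" "u = f u'" "v = f v'"
      using f unfolding bij_betw_def by blast
    then have "{u', v'} \<in> edges G" "e = f ` {u', v'}" using iff[of u' v'] e uv by auto
    then show "e \<in> image f ` edges G" by (rule rev_image_eqI)
  qed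
  ultimately show ?thesis by (metis card_image)
qed

lemma isomorphic_refl: "isomorphic G G"
  unfolding isomorphic_def by (rule exI[of _ id]) simp

text \<open>On a fixed vertex set the edited graph is determined by its edge set, a member of a
  finite power set. Finiteness gives \<open>Min\<close> its meaning.\<close>

lemma finite_edit_dist_set:
  assumes "finite (verts G)"
  shows "finite {card ((edges G - edges G') \<union> (edges G' - edges G)) | G'.
     simple_graph G' \<and> verts G' = verts G \<and> P G'}"
proof (rule finite_surj)
  show "finite (Pow (pairs (verts G)))" using assms by (simp add: finite_pairs)
  show "{card ((edges G - edges G') \<union> (edges G' - edges G)) | G'.
     simple_graph G' \<and> verts G' = verts G \<and> P G'}
     \<subseteq> (\<lambda>E. card ((edges G - E) \<union> (E - edges G))) ` Pow (pairs (verts G))"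
    by (auto simp: simple_graph_iff)
qed

lemma edit_dist_le:
  assumes "simple_graph G" "simple_graph G'" "verts G' = verts G" "H \<in> \<H>" "isomorphic G' H"
  shows "edit_dist G \<H> \<le> card ((edges G - edges G') \<union> (edges G' - edges G))"
  unfolding edit_dist_def
proof (rule Min_le[OF finite_edit_dist_set])
  show "finite (verts G)" using assms(1) by (simp add: simple_graph_def)
qed (use assms in blast)

text \<open>\<open>G0\<close> and \<open>H0\<close> only witness that the set under
  \<open>Min\<close> is nonempty.\<close>

lemma edit_dist_attained:
  assumes "simple_graph G" "simple_graph G0" "verts G0 = verts G" "H0 \<in> \<H>" "isomorphic G0 H0"
  obtains G' H where "simple_graph G'" "verts G' = verts G" "H \<in> \<H>" "isomorphic G' H"
    "edit_dist G \<H> = card ((edges G - edges G') \<union> (edges G' - edges G))"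
proof -
  let ?S = "{card ((edges G - edges G') \<union> (edges G' - edges G)) | G'.
     simple_graph G' \<and> verts G' = verts G \<and> (\<exists>H\<in>\<H>. isomorphic G' H)}"
  have "finite (verts G)" using assms(1) by (simp add: simple_graph_def)
  then have "finite ?S" by (rule finite_edit_dist_set)
  moreover have "?S \<noteq> {}" using assms by blast
  ultimately have "edit_dist G \<H> \<in> ?S" unfolding edit_dist_def by (rule Min_in)
  then show ?thesis using that by blast
qed

section \<open>The two bounds\<close>

text \<open>The distances to the empty and to the complete graph add up to
  \<open>n choose 2\<close>, so the smaller is at most half of it.\<close>

lemma edit_dist_no_induced_4_3_upper:
  fixes G :: "nat graph"
  assumes "simple_graph G" "card (verts G) = n"
  shows "2 * edit_dist G (no_induced_4_3 n) \<le> n choose 2"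
proof -
  have fin: "finite (verts G)" and E: "edges G \<subseteq> pairs (verts G)"
    using assms(1) by (auto simp: simple_graph_iff)
  have le: "edit_dist G (no_induced_4_3 n) \<le> card ((edges G - E) \<union> (E - edges G))"
    if "good (verts G) E" for E
  proof -
    have "(verts G, E) \<in> no_induced_4_3 n" using that assms(2) by (rule no_induced_4_3_if_good)
    moreover have "simple_graph (verts G, E)" using that by (simp add: simple_graph_iff good_def)
    ultimately show ?thesis using edit_dist_le[OF assms(1), of "(verts G, E)"] isomorphic_refl by fastforce
  qed
  have "good (verts G) (pairs (verts G))"
    using good_complement[OF good_empty[OF fin]] by simp
  then have "edit_dist G (no_induced_4_3 n) \<le> card (pairs (verts G) - edges G)"
    using le[of "pairs (verts G)"] E by (simp add: Diff_eq_empty_iff[THEN iffD2])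
  moreover have "edit_dist G (no_induced_4_3 n) \<le> card (edges G)"
    using le[OF good_empty[OF fin]] by simp
  moreover have "card (pairs (verts G) - edges G) + card (edges G) = n choose 2"
    using card_pairs[OF fin] assms(2) E finite_pairs[OF fin]
    by (metis add.commute card_Diff_subset card_mono finite_subset le_add_diff_inverse)
  ultimately show ?thesis by linarith
qed

lemma card_le_card_symdiff:
  assumes "finite A" "finite B"
  shows "card A \<le> card B + card ((A - B) \<union> (B - A))"
proof -
  have "card A \<le> card (B \<union> ((A - B) \<union> (B - A)))" using assms by (intro card_mono) auto
  then show ?thesis using card_Un_le le_trans by blast
qed

lemma edit_dist_no_induced_4_3_lower:
  fixes G :: "nat graph"
  assumes "simple_graph G" "card (verts G) = n" "card (edges G) = (n choose 2) div 2"
  shows "(n choose 2) div 2 \<le> edit_dist G (no_induced_4_3 n) + n"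
proof -
  have fin: "finite (verts G)" using assms(1) by (simp add: simple_graph_def)
  have "simple_graph (verts G, {})" using fin by (simp add: simple_graph_def)
  moreover have "(verts G, {}) \<in> no_induced_4_3 n"
    using good_empty[OF fin] assms(2) by (rule no_induced_4_3_if_good)
  ultimately obtain G' H where G': "simple_graph G'" "verts G' = verts G"
    and H: "H \<in> no_induced_4_3 n" "isomorphic G' H"
    and dist: "edit_dist G (no_induced_4_3 n) = card ((edges G - edges G') \<union> (edges G' - edges G))"
    using edit_dist_attained[OF assms(1), of "(verts G, {})"] isomorphic_refl by (metis fst_conv)
  have "simple_graph H" "card (verts H) = n" using H(1) by (auto simp: no_induced_4_3_def)
  then have "card (edges G') \<le> n \<or> n choose 2 \<le> card (edges G') + n"
    using good_few_or_many_edges[OF good_if_no_induced_4_3[OF H(1)]]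
      isomorphic_card_edges[OF G'(1) _ H(2)] by simp
  moreover have "finite (edges G)" "finite (edges G')"
    using assms(1) G' fin finite_subset[OF _ finite_pairs] by (auto simp: simple_graph_iff)
  \<comment> \<open>With N = \<open>n choose 2\<close>, either \<open>G'\<close> has at most n edges
    and about N/2 - n edges of \<open>G\<close> must go, or it has at least N - n and as many must
    be added. Rounding N/2 down is safe in both cases, since N - N div 2 \<ge> N div 2.\<close>
  ultimately show ?thesis
    using card_le_card_symdiff[of "edges G" "edges G'"] card_le_card_symdiff[of "edges G'" "edges G"]
      assms(3) dist by (simp add: Un_commute) linarith
qed

lemma real_choose_two: "real (n choose 2) = ((real n)\<^sup>2 - real n) / 2"
  by (induction n) (auto simp: choose_two numeral_2_eq_2 power2_eq_square field_simps)

theorem theorem5p2: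
  fixes n :: nat
  shows "real_of_int \<lfloor>((real n)\<^sup>2 - 5 * real n) / 4\<rfloor> \<le> real (max_edit_dist n (no_induced_4_3 n)) \<and>
    real (max_edit_dist n (no_induced_4_3 n)) \<le> ((real n)\<^sup>2 - real n) / 4"
proof -
  let ?N = "n choose 2"
  let ?S = "{edit_dist G (no_induced_4_3 n) | G :: nat graph. simple_graph G \<and> card (verts G) = n}"
  have upper: "2 * d \<le> ?N" if "d \<in> ?S" for d
    using that edit_dist_no_induced_4_3_upper by blast
  \<comment> \<open>The upper bound also makes the set finite, as \<open>Max\<close>
    requires.\<close>
  then have "?S \<subseteq> {..?N}" by fastforce
  then have fin: "finite ?S" by (rule finite_subset) simp
  have "?N div 2 \<le> card (pairs {..<n})" by (simp add: card_pairs)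
  then obtain E where E: "E \<subseteq> pairs {..<n}" "card E = ?N div 2"
    using obtain_subset_with_card_n by metis
  define G where "G = ({..<n}, E)"
  have G: "simple_graph G" "card (verts G) = n" "card (edges G) = ?N div 2"
    using E by (auto simp: G_def simple_graph_iff)
  then have inS: "edit_dist G (no_induced_4_3 n) \<in> ?S" by blast
  then have "2 * max_edit_dist n (no_induced_4_3 n) \<le> ?N"
    unfolding max_edit_dist_def using upper Max_in[OF fin] by blast
  then have "2 * real (max_edit_dist n (no_induced_4_3 n)) \<le> real ?N"
    by (metis of_nat_le_iff of_nat_mult of_nat_numeral)
  moreover have "?N div 2 \<le> max_edit_dist n (no_induced_4_3 n) + n"
    using edit_dist_no_induced_4_3_lower[OF G] Max_ge[OF fin inS] unfolding max_edit_dist_def by linarith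
  \<comment> \<open>The quotient equals \<open>?N / 2 - n\<close>, and the integer n leaves the
    floor. The difference is taken in \<open>int\<close> because it is negative for small positive
    n.\<close>
  moreover have "\<lfloor>((real n)\<^sup>2 - 5 * real n) / 4\<rfloor> = int (?N div 2) - int n"
  proof -
    have "((real n)\<^sup>2 - 5 * real n) / 4 = real ?N / 2 - of_int (int n)"
      by (simp add: real_choose_two field_simps)
    then show ?thesis
      using floor_divide_of_nat_eq[of ?N 2, where 'a = real] by (simp only: floor_diff_of_int) simp
  qed
  ultimately show ?thesis by (simp add: real_choose_two)
qed

end
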